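(* Let $(\mathfrak g,[\cdot,\cdot],\alpha,B)$ be a finite-dimensional RQH-Lie algebra over $\mathbb K$. Then it is obtained from a centerless IQH-Lie algebra by a finite sequence of regular double extensions by the one-dimensional Lie algebra and/or orthogonal direct sums of RQH-Lie algebras.
   Context: $\mathbb K$ is an algebraically closed field of characteristic $0$. A Hom-Lie algebra is a triple $(\mathfrak g,[\cdot,\cdot],\alpha)$ with $[\cdot,\cdot]$ a skew-symmetric bilinear bracket and $\alpha$ a linear map such that $[\alpha(x),[y,z]]+[\alpha(y),[z,x]]+[\alpha(z),[x,y]]=0$ for all $x,y,z$; it is multiplicative if $\alpha([x,y])=[\alpha(x),\alpha(y)]$. It is quadratic with form $B$ if $B$ is a symmetric nondegenerate bilinear form with $B([x,y],z)=B(x,[y,z])$ and $B(\alpha(x),y)=B(x,\alpha(y))$. An RQH-Lie algebra (regular quadratic Hom-Lie algebra) is a multiplicative quadratic Hom-Lie algebra with $\alpha$ invertible; an IQH-Lie algebra (involutive quadratic Hom-Lie algebra) is one with $\alpha^2=\mathrm{id}$. Centerless means $\mathcal Z(\mathfrak g)=\{x:[x,y]=0\ \forall y\}=\{0\}$. The orthogonal direct sum of quadratic Hom-Lie algebras is the direct sum of vector spaces with componentwise bracket, twist map and form. Regular double extension by the one-dimensional Lie algebra: given an RQH-Lie algebra $(V,[\cdot,\cdot]_V,\alpha_V,B_V)$, a $B_V$-skew-symmetric linear map $\delta:V\to V$, $x_0\in V$, $\lambda\in\mathbb K\setminus\{0\}$, $\lambda_0\in\mathbb K$ such that, with $\rho_V(x)=[x,\cdot]_V$,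 one has $\alpha_V\delta\alpha_V-\lambda\delta=\rho_V(x_0)$, $\alpha_V\delta^2-\delta^2\alpha_V=\rho_V(\delta(x_0))$, and $(\lambda\delta+\rho_V(x_0))([x,y]_V)=[\delta(x),\alpha_V(y)]_V+[\alpha_V(x),\delta(y)]_V$ for all $x,y\in V$, it is the space $\mathbb K b\oplus V\oplus\mathbb K e$ with skew-symmetric bracket $[x,y]=[x,y]_V+B_V(\delta(x),y)e$, $[b,x]=\delta(x)$, $[e,\cdot]=0$; twist map $\alpha(x)=\alpha_V(x)+B_V(x_0,x)e$, $\alpha(b)=\lambda b+x_0+\lambda_0e$, $\alpha(e)=\lambda e$ ($x,y\in V$); and symmetric form $B$ equal to $B_V$ on $V$ with $B(b,e)=1$, $B(V,b)=B(V,e)=0$, $B(b,b)=B(e,e)=0$. *)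

theory Defs
  imports "HOL-Computational_Algebra.Polynomial" "HOL-Library.Product_Plus"
begin

text \<open>
  The underlying space of an algebra is a subspace \<open>carrier\<close> of the type \<open>'v\<close>, regarded as a vector
  space through \<open>scale\<close>; \<open>carrier = UNIV\<close> gives an arbitrary vector space. The operations matter
  only on the carrier.
\<close>

record ('k, 'v) hom_lie =
  carrier :: "'v set"
  scale :: "'k \<Rightarrow> 'v \<Rightarrow> 'v"
  bracket :: "'v \<Rightarrow> 'v \<Rightarrow> 'v"
  twist :: "'v \<Rightarrow> 'v"
  form :: "'v \<Rightarrow> 'v \<Rightarrow> 'k"

definition linear_map_on ::
  "'a::ab_group_add set \<Rightarrow> ('k \<Rightarrow> 'a \<Rightarrow> 'a) \<Rightarrow> ('k \<Rightarrow> 'b \<Rightarrow> 'b) \<Rightarrow> ('a \<Rightarrow> 'b::ab_group_add) \<Rightarrow> bool"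
  where
  "linear_map_on S s t f \<longleftrightarrow>
     (\<forall>x\<in>S. \<forall>y\<in>S. f (x + y) = f x + f y) \<and> (\<forall>c. \<forall>x\<in>S. f (s c x) = t c (f x))"

definition bilinear_map_on ::
  "'a::ab_group_add set \<Rightarrow> ('k \<Rightarrow> 'a \<Rightarrow> 'a) \<Rightarrow> ('k \<Rightarrow> 'b \<Rightarrow> 'b) \<Rightarrow> ('a \<Rightarrow> 'a \<Rightarrow> 'b::ab_group_add) \<Rightarrow> bool"
  where
  "bilinear_map_on S s t f \<longleftrightarrow>
     (\<forall>x\<in>S. linear_map_on S s t (f x)) \<and> (\<forall>y\<in>S. linear_map_on S s t (\<lambda>x. f x y))"

definition hom_Lie_algebra :: "('k::field, 'v::ab_group_add) hom_lie \<Rightarrow> bool" where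
  "hom_Lie_algebra g \<longleftrightarrow>
     vector_space (scale g) \<and> module.subspace (scale g) (carrier g) \<and>
     (\<forall>x\<in>carrier g. \<forall>y\<in>carrier g. bracket g x y \<in> carrier g) \<and>
     bilinear_map_on (carrier g) (scale g) (scale g) (bracket g) \<and>
     (\<forall>x\<in>carrier g. twist g x \<in> carrier g) \<and>
     linear_map_on (carrier g) (scale g) (scale g) (twist g) \<and>
     (\<forall>x\<in>carrier g. \<forall>y\<in>carrier g. bracket g x y = - bracket g y x) \<and>
     (\<forall>x\<in>carrier g. \<forall>y\<in>carrier g. \<forall>z\<in>carrier g.
        bracket g (twist g x) (bracket g y z) + bracket g (twist g y) (bracket g z x)
          + bracket g (twist g z) (bracket g x y) = 0)"

definition multiplicative :: "('k::field, 'v::ab_group_add) hom_lie \<Rightarrow> bool" where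
  "multiplicative g \<longleftrightarrow>
     (\<forall>x\<in>carrier g. \<forall>y\<in>carrier g. twist g (bracket g x y) = bracket g (twist g x) (twist g y))"

definition quadratic_hom_Lie_algebra :: "('k::field, 'v::ab_group_add) hom_lie \<Rightarrow> bool" where
  "quadratic_hom_Lie_algebra g \<longleftrightarrow>
     hom_Lie_algebra g \<and>
     bilinear_map_on (carrier g) (scale g) (*) (form g) \<and>
     (\<forall>x\<in>carrier g. \<forall>y\<in>carrier g. form g x y = form g y x) \<and>
     (\<forall>x\<in>carrier g. (\<forall>y\<in>carrier g. form g x y = 0) \<longrightarrow> x = 0) \<and>
     (\<forall>x\<in>carrier g. \<forall>y\<in>carrier g. \<forall>z\<in>carrier g.
        form g (bracket g x y) z = form g x (bracket g y z)) \<and>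
     (\<forall>x\<in>carrier g. \<forall>y\<in>carrier g. form g (twist g x) y = form g x (twist g y))"

definition RQH_Lie_algebra :: "('k::field, 'v::ab_group_add) hom_lie \<Rightarrow> bool" where
  "RQH_Lie_algebra g \<longleftrightarrow>
     quadratic_hom_Lie_algebra g \<and> multiplicative g \<and>
     bij_betw (twist g) (carrier g) (carrier g)"

definition IQH_Lie_algebra :: "('k::field, 'v::ab_group_add) hom_lie \<Rightarrow> bool" where
  "IQH_Lie_algebra g \<longleftrightarrow>
     quadratic_hom_Lie_algebra g \<and> multiplicative g \<and>
     (\<forall>x\<in>carrier g. twist g (twist g x) = x)"

definition center :: "('k, 'v::ab_group_add) hom_lie \<Rightarrow> 'v set" where
  "center g = {x \<in> carrier g. \<forall>y\<in>carrier g. bracket g x y = 0}"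

definition centerless :: "('k, 'v::ab_group_add) hom_lie \<Rightarrow> bool" where
  "centerless g \<longleftrightarrow> center g = {0}"

definition finite_dimensional :: "('k::field, 'v::ab_group_add) hom_lie \<Rightarrow> bool" where
  "finite_dimensional g \<longleftrightarrow> (\<exists>S. finite S \<and> module.span (scale g) S = carrier g)"

definition one_dimensional :: "('k::field, 'v::ab_group_add) hom_lie \<Rightarrow> bool" where
  "one_dimensional g \<longleftrightarrow> vector_space.dim (scale g) (carrier g) = 1"

definition isometric ::
  "('k::field, 'v::ab_group_add) hom_lie \<Rightarrow> ('k, 'w::ab_group_add) hom_lie \<Rightarrow> bool" where
  "isometric g h \<longleftrightarrow>
     (\<exists>f. bij_betw f (carrier g) (carrier h) \<and>
          linear_map_on (carrier g) (scale g) (scale h) f \<and>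
          (\<forall>x\<in>carrier g. \<forall>y\<in>carrier g. f (bracket g x y) = bracket h (f x) (f y)) \<and>
          (\<forall>x\<in>carrier g. f (twist g x) = twist h (f x)) \<and>
          (\<forall>x\<in>carrier g. \<forall>y\<in>carrier g. form h (f x) (f y) = form g x y))"

definition orthogonal_sum ::
  "('k::field, 'v::ab_group_add) hom_lie \<Rightarrow> ('k, 'w::ab_group_add) hom_lie \<Rightarrow> ('k, 'v \<times> 'w) hom_lie"
  where
  "orthogonal_sum V W =
     \<lparr> carrier = carrier V \<times> carrier W,
       scale = (\<lambda>c (x, y). (scale V c x, scale W c y)),
       bracket = (\<lambda>(x, y) (x', y'). (bracket V x x', bracket W y y')),
       twist = (\<lambda>(x, y). (twist V x, twist W y)),
       form = (\<lambda>(x, y) (x', y'). form V x x' + form W y y') \<rparr>"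

definition double_extension_data ::
  "('k::field, 'v::ab_group_add) hom_lie \<Rightarrow> ('v \<Rightarrow> 'v) \<Rightarrow> 'v \<Rightarrow> 'k \<Rightarrow> bool" where
  "double_extension_data V \<delta> x0 \<mu> \<longleftrightarrow>
     RQH_Lie_algebra V \<and>
     (\<forall>x\<in>carrier V. \<delta> x \<in> carrier V) \<and>
     linear_map_on (carrier V) (scale V) (scale V) \<delta> \<and>
     (\<forall>x\<in>carrier V. \<forall>y\<in>carrier V. form V (\<delta> x) y = - form V x (\<delta> y)) \<and>
     x0 \<in> carrier V \<and> \<mu> \<noteq> 0 \<and>
     (\<forall>x\<in>carrier V. twist V (\<delta> (twist V x)) - scale V \<mu> (\<delta> x) = bracket V x0 x) \<and>
     (\<forall>x\<in>carrier V. twist V (\<delta> (\<delta> x)) - \<delta> (\<delta> (twist V x)) = bracket V (\<delta> x0) x) \<and>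
     (\<forall>x\<in>carrier V. \<forall>y\<in>carrier V.
        scale V \<mu> (\<delta> (bracket V x y)) + bracket V x0 (bracket V x y)
          = bracket V (\<delta> x) (twist V y) + bracket V (twist V x) (\<delta> y))"

text \<open>
  The triple \<open>(s, x, t)\<close> stands for \<open>s b + x + t e\<close>; the formulas are the bilinear (linear) extensions
  of \<open>[x, y] = [x, y]\<^sub>V + B\<^sub>V(\<delta> x, y) e\<close>, \<open>[b, x] = \<delta> x\<close>, \<open>[e, \<cdot>] = 0\<close>,
  \<open>\<alpha>(x) = \<alpha>\<^sub>V x + B\<^sub>V(x\<^sub>0, x) e\<close>, \<open>\<alpha>(b) = \<mu> b + x\<^sub>0 + \<mu>\<^sub>0 e\<close>, \<open>\<alpha>(e) = \<mu> e\<close>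
  and \<open>B(b, e) = 1\<close>.
\<close>

definition double_extension ::
  "('k::field, 'v::ab_group_add) hom_lie \<Rightarrow> ('v \<Rightarrow> 'v) \<Rightarrow> 'v \<Rightarrow> 'k \<Rightarrow> 'k \<Rightarrow> ('k, 'k \<times> 'v \<times> 'k) hom_lie"
  where
  "double_extension V \<delta> x0 \<mu> \<mu>0 =
     \<lparr> carrier = UNIV \<times> carrier V \<times> UNIV,
       scale = (\<lambda>c (s, x, t). (c * s, scale V c x, c * t)),
       bracket = (\<lambda>(s, x, t) (s', x', t').
         (0, bracket V x x' + scale V s (\<delta> x') - scale V s' (\<delta> x), form V (\<delta> x) x')),
       twist = (\<lambda>(s, x, t).
         (\<mu> * s, scale V s x0 + twist V x, \<mu>0 * s + form V x0 x + \<mu> * t)),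
       form = (\<lambda>(s, x, t) (s', x', t'). form V x x' + s * t' + t * s') \<rparr>"

text \<open>
  \<open>obtained_from g0 g\<close>: finitely many double extensions and orthogonal direct sums, each taken up to
  isometry, lead from \<open>g0\<close> to \<open>g\<close>. All intermediate algebras have carriers in the same type \<open>'v\<close>; the
  isometry in each step absorbs the change of the underlying type.

  A summand \<open>W\<close> is an RQH-Lie algebra that is itself obtained from a centerless IQH-Lie algebra, or a
  one-dimensional RQH-Lie algebra. Admitting every RQH-Lie algebra as \<open>W\<close> would make the
  decomposition theorem void, since every \<open>g\<close> is \<open>0 \<oplus> g\<close> and \<open>0\<close> is centerless. The one-dimensional ones
  cannot be left out: they are not centerless, are too small to be double extensions and have
  no proper orthogonal decomposition.
\<close>

inductive obtained_from ::
  "('k::field, 'v::ab_group_add) hom_lie \<Rightarrow> ('k, 'v) hom_lie \<Rightarrow> bool" where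
  start: "obtained_from g0 g0"
| double_ext:
    "obtained_from g0 V \<Longrightarrow> double_extension_data V \<delta> x0 \<mu> \<Longrightarrow>
     isometric (double_extension V \<delta> x0 \<mu> \<mu>0) g \<Longrightarrow> obtained_from g0 g"
| orth_sum:
    "obtained_from g0 V \<Longrightarrow> RQH_Lie_algebra V \<Longrightarrow>
     IQH_Lie_algebra h0 \<Longrightarrow> centerless h0 \<Longrightarrow> obtained_from h0 W \<Longrightarrow> RQH_Lie_algebra W \<Longrightarrow>
     isometric (orthogonal_sum V W) g \<Longrightarrow> obtained_from g0 g"
| orth_sum_one_dim:
    "obtained_from g0 V \<Longrightarrow> RQH_Lie_algebra V \<Longrightarrow>
     RQH_Lie_algebra (W :: ('k, 'v) hom_lie) \<Longrightarrow> one_dimensional W \<Longrightarrow>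
     isometric (orthogonal_sum V W) g \<Longrightarrow> obtained_from g0 g"

end

theory Submission
  imports Defs
begin

text \<open>
  Invariance of the form and multiplicativity make \<open>\<alpha>\<^sup>2 - id\<close> take values in the centre, so a
  centerless RQH-Lie algebra is involutive. Otherwise the centre, being \<open>\<alpha>\<close>-stable, contains an
  eigenvector \<open>e\<close>. If \<open>e\<close> is anisotropic, \<open>\<langle>e\<rangle>\<close> splits off orthogonally. If \<open>e\<close> is isotropic, choose
  an isotropic \<open>b\<close> with \<open>B(e, b) = 1\<close>: then \<open>g\<close> is the double extension of \<open>e\<^sup>\<bottom> / \<langle>e\<rangle>\<close> by \<open>\<delta> = [b, \<cdot>]\<close>.
  Both steps lower the dimension.
\<close>

section \<open>Finite-dimensional subspaces and eigenvectors\<close>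

context vector_space
begin

text \<open>A basis of \<open>V\<close> stays independent after \<open>e\<close> is adjoined, so the
  exchange bound makes it strictly smaller than \<open>S\<close>. This strict drop drives the final
  induction.\<close>

lemma proper_subspace_span_card:
  assumes "finite S" "subspace V" "V \<subseteq> span S" "e \<in> span S" "e \<notin> V"
  obtains T where "finite T" "card T < card S" "span T = V"
proof -
  obtain T where T: "T \<subseteq> V" "independent T" "V \<subseteq> span T"
    by (rule maximal_independent_subset)
  have span: "span T = V"
    using span_minimal[OF T(1) assms(2)] T(3) by (rule subset_antisym)
  have "independent (insert e T)"
    using T(2) assms(5) by (intro independent_insertI) (simp_all add: span)
  moreover have "insert e T \<subseteq> span S"
    using subset_trans[OF T(1) assms(3)] assms(4) by simp
  ultimately have card: "finite (insert e T) \<and> card (insert e T) \<le> card S"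
    by (rule independent_span_bound[OF assms(1)])
  have "e \<notin> T"
    using T(1) assms(5) by (rule contra_subsetD)
  then have "card T < card S"
    using conjunct1[OF card] conjunct2[OF card] by simp
  then show thesis
    using card span by (intro that[of T]) simp_all
qed

end

text \<open>For a linear map \<open>f\<close> this is \<open>p(f)\<close> applied to \<open>z\<close>, evaluated by Horner's rule.\<close>
definition poly_act ::
  "('k::zero \<Rightarrow> 'v \<Rightarrow> 'v) \<Rightarrow> ('v \<Rightarrow> 'v) \<Rightarrow> 'v::ab_group_add \<Rightarrow> 'k poly \<Rightarrow> 'v" where
  "poly_act s f z p = fold_coeffs (\<lambda>a v. s a z + f v) p 0"

lemma poly_act_0 [simp]: "poly_act s f z 0 = 0"
  by (simp add: poly_act_def)

text \<open>The polynomial \<open>pCons 0 0\<close> is zero and has no coefficients, so Horner's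
  rule does not unfold there; the two hypotheses make this case agree with the others.\<close>

lemma poly_act_pCons:
  assumes "f 0 = 0" "s 0 z = 0"
  shows "poly_act s f z (pCons a p) = s a z + f (poly_act s f z p)"
proof (cases "p = 0 \<and> a = 0")
  case True
  then show ?thesis
    using assms by simp
next
  case False
  then have "coeffs (pCons a p) = a # coeffs p"
    by (auto simp: cCons_def)
  then show ?thesis
    by (simp add: poly_act_def fold_coeffs_def)
qed

text \<open>Take p of least degree among the nonzero polynomials with p(f) z = 0 and factor it as (X
  - r) q. By minimality q(f) z is nonzero, and f multiplies it by r.\<close>

lemma eigenvector_exists:
  fixes s :: "'k::alg_closed_field \<Rightarrow> 'v::ab_group_add \<Rightarrow> 'v" (infixr \<open>*s\<close> 75)
  assumes "vector_space s"
    and S: "finite S" and V: "module.subspace s V" "V \<subseteq> module.span s S"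
    and f: "\<And>x. x \<in> V \<Longrightarrow> f x \<in> V" "linear_map_on V s s f"
    and z: "z \<in> V" "z \<noteq> 0"
  obtains v r where "v \<in> V" "v \<noteq> 0" "f v = r *s v"
proof -
  interpret vector_space s by fact
  have f_add: "f (x + y) = f x + f y" if "x \<in> V" "y \<in> V" for x y
    using f(2) that by (simp add: linear_map_on_def)
  have f_scale: "f (c *s x) = c *s f x" if "x \<in> V" for c x
    using f(2) that by (simp add: linear_map_on_def)
  have f0: "f 0 = 0"
    using f_scale[OF z(1), of 0] by simp
  note [simp] = poly_act_pCons[of f s, OF f0 scale_zero_left]
  have act_mem [simp]: "poly_act s f z p \<in> V" for p
    by (induction p) (simp_all add: V f z subspace_0 subspace_add subspace_scale)
  have act_add: "poly_act s f z (p + q) = poly_act s f z p + poly_act s f z q" for p q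
    by (induction p q rule: poly_induct2) (simp_all add: f_add scale_left_distrib)
  have act_smult: "poly_act s f z (smult c p) = c *s poly_act s f z p" for c p
    by (induction p) (simp_all add: f_scale scale_right_distrib)
  have act_sum: "poly_act s f z (sum h A) = (\<Sum>a\<in>A. poly_act s f z (h a))" for h and A :: "nat set"
    by (induction A rule: infinite_finite_induct) (simp_all add: act_add)
  have "\<exists>p. p \<noteq> 0 \<and> poly_act s f z p = 0"
  proof -
    define w where "w i = poly_act s f z (monom 1 i)" for i
    show ?thesis
    \<comment> \<open>If two of the vectors f^i(z) coincide, then X^i - X^j already annihilates z.
      Otherwise there are \<open>card S + 1\<close> distinct vectors in \<open>span S\<close>, and
      their set is dependent.\<close>
    proof (cases "inj_on w {..card S}")
      case False
      then obtain i j where ij: "i \<noteq> j" "w i = w j"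
        by (auto simp: inj_on_def)
      have "poly_act s f z (monom 1 i + smult (- 1) (monom 1 j)) = 0"
        using ij(2) by (simp add: act_add act_smult w_def del: smult_minus_left)
      moreover have "coeff (monom 1 i + smult (- 1) (monom 1 j) :: 'k poly) i = 1"
        using ij(1) by simp
      then have "(monom 1 i + smult (- 1) (monom 1 j) :: 'k poly) \<noteq> 0"
        by (metis coeff_0 zero_neq_one)
      ultimately show ?thesis by blast
    next
      case True
      then have card: "card (w ` {..card S}) = Suc (card S)"
        by (simp add: card_image)
      have "w ` {..card S} \<subseteq> span S"
        using V act_mem by (auto simp: w_def)
      then have "dependent (w ` {..card S})"
        using independent_span_bound[OF S, of "w ` {..card S}"] card by auto
      then obtain u v where uv: "v \<in> w ` {..card S}" "u v \<noteq> 0"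
          "(\<Sum>v\<in>w ` {..card S}. u v *s v) = 0"
        using dependent_finite[of "w ` {..card S}"] by blast
      then obtain i where u: "i \<le> card S" "u (w i) \<noteq> 0"
        by blast
      \<comment> \<open>Injectivity of \<open>w\<close> turns the relation among vectors into
        coefficients indexed by exponents.\<close>
      define p where "p = (\<Sum>i\<le>card S. smult (u (w i)) (monom 1 i))"
      have "poly_act s f z p = (\<Sum>i\<le>card S. u (w i) *s w i)"
        by (simp only: p_def act_sum act_smult w_def)
      also have "\<dots> = 0"
        using uv(3) True by (simp add: sum.reindex)
      finally have "poly_act s f z p = 0" .
      moreover have "coeff p i = u (w i)"
        using u(1) by (simp add: p_def coeff_sum if_distrib sum.delta cong: if_cong)
      then have "p \<noteq> 0"
        using u(2) by auto
      ultimately show ?thesis by blast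
    qed
  qed
  then obtain p where p: "p \<noteq> 0" "poly_act s f z p = 0"
    and min: "\<And>q. q \<noteq> 0 \<Longrightarrow> poly_act s f z q = 0 \<Longrightarrow> degree p \<le> degree q"
    using ex_has_least_nat[of "\<lambda>p. p \<noteq> 0 \<and> poly_act s f z p = 0" _ degree] by blast
  have "degree p > 0"
  proof (rule ccontr)
    assume "\<not> degree p > 0"
    then obtain a where "p = [:a:]"
      using degree_eq_zeroE by blast
    then show False
      using p z by (simp add: f0)
  qed
  then obtain r where "poly p r = 0"
    using alg_closed_imp_poly_has_root by blast
  then obtain q where q: "p = [:- r, 1:] * q"
    by (auto simp: poly_eq_0_iff_dvd elim: dvdE)
  have "q \<noteq> 0"
    using p(1) q by auto
  then have "degree p = Suc (degree q)"
    unfolding q by (subst degree_mult_eq) auto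
  then have "poly_act s f z q \<noteq> 0"
    using min[of q] \<open>q \<noteq> 0\<close> by auto
  \<comment> \<open>Here \<open>pCons 0 q\<close> is X q, so p(f) z = 0 reads f(v) = r v for v =
    q(f) z.\<close>
  moreover have "p = pCons 0 q + smult (- r) q"
    using q by simp
  then have "f (poly_act s f z q) = r *s poly_act s f z q"
    using p(2) by (simp add: act_add act_smult del: smult_minus_left)
  ultimately show thesis
    using that act_mem by blast
qed

section \<open>Reduction by a central eigenvector\<close>

locale RQH =
  fixes g :: "('k::field, 'v::ab_group_add) hom_lie"
  assumes RQH: "RQH_Lie_algebra g"
begin

abbreviation smul (infixr \<open>\<cdot>\<close> 75) where "smul \<equiv> scale g"

lemma RQH_conjuncts:
  shows vector_space_scale: "vector_space smul"
    and "module.subspace smul (carrier g)"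
    and "\<forall>x\<in>carrier g. \<forall>y\<in>carrier g. bracket g x y \<in> carrier g"
    and "bilinear_map_on (carrier g) smul smul (bracket g)"
    and "\<forall>x\<in>carrier g. twist g x \<in> carrier g"
    and "linear_map_on (carrier g) smul smul (twist g)"
    and "\<forall>x\<in>carrier g. \<forall>y\<in>carrier g. bracket g x y = - bracket g y x"
    and "\<forall>x\<in>carrier g. \<forall>y\<in>carrier g. \<forall>z\<in>carrier g.
        bracket g (twist g x) (bracket g y z) + bracket g (twist g y) (bracket g z x)
          + bracket g (twist g z) (bracket g x y) = 0"
    and "bilinear_map_on (carrier g) smul (*) (form g)"
    and "\<forall>x\<in>carrier g. \<forall>y\<in>carrier g. form g x y = form g y x"
    and "\<forall>x\<in>carrier g. (\<forall>y\<in>carrier g. form g x y = 0) \<longrightarrow> x = 0"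
    and "\<forall>x\<in>carrier g. \<forall>y\<in>carrier g. \<forall>z\<in>carrier g.
        form g (bracket g x y) z = form g x (bracket g y z)"
    and "\<forall>x\<in>carrier g. \<forall>y\<in>carrier g. form g (twist g x) y = form g x (twist g y)"
    and "\<forall>x\<in>carrier g. \<forall>y\<in>carrier g. twist g (bracket g x y) = bracket g (twist g x) (twist g y)"
    and "bij_betw (twist g) (carrier g) (carrier g)"
  using RQH
  unfolding RQH_Lie_algebra_def quadratic_hom_Lie_algebra_def hom_Lie_algebra_def multiplicative_def
  by - (elim conjE, assumption)+

sublocale vector_space smul
  by (rule vector_space_scale)

lemma mem [simp]:
  shows zero_mem: "0 \<in> carrier g"
    and add_mem: "\<And>x y. x \<in> carrier g \<Longrightarrow> y \<in> carrier g \<Longrightarrow> x + y \<in> carrier g"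
    and diff_mem: "\<And>x y. x \<in> carrier g \<Longrightarrow> y \<in> carrier g \<Longrightarrow> x - y \<in> carrier g"
    and neg_mem: "\<And>x. x \<in> carrier g \<Longrightarrow> - x \<in> carrier g"
    and scale_mem: "\<And>c x. x \<in> carrier g \<Longrightarrow> c \<cdot> x \<in> carrier g"
    and bracket_mem: "\<And>x y. x \<in> carrier g \<Longrightarrow> y \<in> carrier g \<Longrightarrow> bracket g x y \<in> carrier g"
    and twist_mem: "\<And>x. x \<in> carrier g \<Longrightarrow> twist g x \<in> carrier g"
  using RQH_conjuncts(2,3,5)
  by (simp_all add: subspace_0 subspace_add subspace_diff subspace_neg subspace_scale)

lemma add_linear [simp]:
  assumes "x \<in> carrier g" "y \<in> carrier g"
  shows "twist g (x + y) = twist g x + twist g y"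
    and "z \<in> carrier g \<Longrightarrow> bracket g (x + y) z = bracket g x z + bracket g y z"
    and "z \<in> carrier g \<Longrightarrow> bracket g z (x + y) = bracket g z x + bracket g z y"
    and "z \<in> carrier g \<Longrightarrow> form g (x + y) z = form g x z + form g y z"
    and "z \<in> carrier g \<Longrightarrow> form g z (x + y) = form g z x + form g z y"
  using assms RQH_conjuncts(4,6,9)
  by (simp_all add: linear_map_on_def bilinear_map_on_def)

lemma scale_linear [simp]:
  assumes "x \<in> carrier g"
  shows "twist g (c \<cdot> x) = c \<cdot> twist g x"
    and "z \<in> carrier g \<Longrightarrow> bracket g (c \<cdot> x) z = c \<cdot> bracket g x z"
    and "z \<in> carrier g \<Longrightarrow> bracket g z (c \<cdot> x) = c \<cdot> bracket g z x"
    and "z \<in> carrier g \<Longrightarrow> form g (c \<cdot> x) z = c * form g x z"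
    and "z \<in> carrier g \<Longrightarrow> form g z (c \<cdot> x) = c * form g z x"
  using assms RQH_conjuncts(4,6,9)
  by (simp_all add: linear_map_on_def bilinear_map_on_def)

lemma zero_linear [simp]:
  shows "twist g 0 = 0"
    and "z \<in> carrier g \<Longrightarrow> bracket g 0 z = 0"
    and "z \<in> carrier g \<Longrightarrow> bracket g z 0 = 0"
    and "z \<in> carrier g \<Longrightarrow> form g 0 z = 0"
    and "z \<in> carrier g \<Longrightarrow> form g z 0 = 0"
  using scale_linear[of 0, where c = 0] by simp_all

lemma neg_linear [simp]:
  assumes "x \<in> carrier g"
  shows "twist g (- x) = - twist g x"
    and "z \<in> carrier g \<Longrightarrow> bracket g (- x) z = - bracket g x z"
    and "z \<in> carrier g \<Longrightarrow> bracket g z (- x) = - bracket g z x"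
    and "z \<in> carrier g \<Longrightarrow> form g (- x) z = - form g x z"
    and "z \<in> carrier g \<Longrightarrow> form g z (- x) = - form g z x"
  using scale_linear[OF assms, where c = "- 1"] by simp_all

lemma diff_linear [simp]:
  assumes "x \<in> carrier g" "y \<in> carrier g"
  shows "twist g (x - y) = twist g x - twist g y"
    and "z \<in> carrier g \<Longrightarrow> bracket g (x - y) z = bracket g x z - bracket g y z"
    and "z \<in> carrier g \<Longrightarrow> bracket g z (x - y) = bracket g z x - bracket g z y"
    and "z \<in> carrier g \<Longrightarrow> form g (x - y) z = form g x z - form g y z"
    and "z \<in> carrier g \<Longrightarrow> form g z (x - y) = form g z x - form g z y"
  using add_linear[OF assms(1) neg_mem[OF assms(2)]] assms by simp_all

lemma bracket_skew: "x \<in> carrier g \<Longrightarrow> y \<in> carrier g \<Longrightarrow> bracket g x y = - bracket g y x"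
  by (rule RQH_conjuncts(7)[rule_format])

lemma jacobi:
  "x \<in> carrier g \<Longrightarrow> y \<in> carrier g \<Longrightarrow> z \<in> carrier g \<Longrightarrow>
    bracket g (twist g x) (bracket g y z) + bracket g (twist g y) (bracket g z x)
      + bracket g (twist g z) (bracket g x y) = 0"
  by (rule RQH_conjuncts(8)[rule_format])

lemma form_sym: "x \<in> carrier g \<Longrightarrow> y \<in> carrier g \<Longrightarrow> form g x y = form g y x"
  by (rule RQH_conjuncts(10)[rule_format])

lemma nondegenerate: "x \<in> carrier g \<Longrightarrow> (\<And>y. y \<in> carrier g \<Longrightarrow> form g x y = 0) \<Longrightarrow> x = 0"
  by (rule RQH_conjuncts(11)[rule_format])

lemma form_invariant:
  "x \<in> carrier g \<Longrightarrow> y \<in> carrier g \<Longrightarrow> z \<in> carrier g \<Longrightarrow>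
    form g (bracket g x y) z = form g x (bracket g y z)"
  by (rule RQH_conjuncts(12)[rule_format])

lemma twist_selfadjoint:
  "x \<in> carrier g \<Longrightarrow> y \<in> carrier g \<Longrightarrow> form g (twist g x) y = form g x (twist g y)"
  by (rule RQH_conjuncts(13)[rule_format])

lemma twist_bracket:
  "x \<in> carrier g \<Longrightarrow> y \<in> carrier g \<Longrightarrow> twist g (bracket g x y) = bracket g (twist g x) (twist g y)"
  by (rule RQH_conjuncts(14)[rule_format])

lemma twist_surj: "y \<in> carrier g \<Longrightarrow> \<exists>x\<in>carrier g. y = twist g x"
  using bij_betw_imp_surj_on[OF RQH_conjuncts(15)] by blast

lemma twist_inj: "x \<in> carrier g \<Longrightarrow> y \<in> carrier g \<Longrightarrow> twist g x = twist g y \<Longrightarrow> x = y"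
  using bij_betw_imp_inj_on[OF RQH_conjuncts(15)] by (blast dest: inj_onD)

text \<open>Both \<open>x\<close> and \<open>\<alpha>\<^sup>2 x\<close> arise by moving \<open>\<alpha>\<close> through the invariant form, so
  \<open>x - \<alpha>\<^sup>2 x\<close> is central.\<close>
lemma bracket_twist_twist:
  assumes x: "x \<in> carrier g" and y: "y \<in> carrier g"
  shows "bracket g (twist g (twist g x)) y = bracket g x y"
proof -
  \<comment> \<open>Writing y as a twisted vector gives a twist that can be moved across the
    form.\<close>
  obtain z where z: "z \<in> carrier g" "y = twist g z"
    using twist_surj[OF y] by blast
  have "form g w (bracket g (twist g (twist g x)) (twist g z) - bracket g x (twist g z)) = 0"
    if w: "w \<in> carrier g" for w
  proof -
    \<comment> \<open>The same scalar is computed twice: first the twist passes to z by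
      self-adjointness, then it is distributed over [w, x] by multiplicativity.\<close>
    have "form g (twist g (bracket g w x)) z = form g w (bracket g x (twist g z))"
      using w x z by (simp add: twist_selfadjoint form_invariant)
    moreover have "form g (twist g (bracket g w x)) z
        = form g w (bracket g (twist g (twist g x)) (twist g z))"
      using w x z by (simp add: twist_bracket form_invariant twist_selfadjoint)
    ultimately show ?thesis
      using w x z by simp
  qed
  then have "bracket g (twist g (twist g x)) (twist g z) - bracket g x (twist g z) = 0"
    using x z by (intro nondegenerate) (auto simp: form_sym)
  then show ?thesis
    using z by simp
qed

lemma centerless_imp_IQH:
  assumes "centerless g"
  shows "IQH_Lie_algebra g"
proof -
  have "twist g (twist g x) = x" if x: "x \<in> carrier g" for x
  proof -
    have "twist g (twist g x) - x \<in> center g"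
      using x by (simp add: center_def bracket_twist_twist)
    then show ?thesis
      using assms by (simp add: centerless_def)
  qed
  then show ?thesis
    using RQH unfolding IQH_Lie_algebra_def RQH_Lie_algebra_def by blast
qed

lemma subspace_center: "subspace (center g)"
  by (rule subspaceI) (auto simp: center_def)

text \<open>By surjectivity every y is a twisted vector, so multiplicativity reduces the bracket to
  the twist of a vanishing one. The twist thus restricts to the center, where an eigenvector can be
  sought.\<close>

lemma twist_center:
  assumes "x \<in> center g"
  shows "twist g x \<in> center g"
proof -
  have "bracket g (twist g x) y = 0" if "y \<in> carrier g" for y
    using assms twist_surj[OF that] twist_bracket[of x] by (auto simp: center_def)
  then show ?thesis
    using assms by (simp add: center_def)
qed

end

section \<open>Subalgebras and splitting off an anisotropic central line\<close>

lemma RQH_restrict: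
  fixes g :: "('k::field, 'v::ab_group_add) hom_lie"
  assumes g: "RQH_Lie_algebra g"
    and S: "S \<subseteq> carrier g" "module.subspace (scale g) S"
    and bracket: "\<And>x y. x \<in> S \<Longrightarrow> y \<in> S \<Longrightarrow> bracket g x y \<in> S"
    and twist: "\<And>x. x \<in> S \<Longrightarrow> twist g x \<in> S" "S \<subseteq> twist g ` S"
    and nondeg: "\<And>x. x \<in> S \<Longrightarrow> (\<And>y. y \<in> S \<Longrightarrow> form g x y = 0) \<Longrightarrow> x = 0"
  shows "RQH_Lie_algebra (g\<lparr>carrier := S\<rparr>)"
proof -
  interpret RQH g by (rule RQH.intro[OF g])
  have mem: "x \<in> carrier g" if "x \<in> S" for x
    using that S by blast
  \<comment> \<open>Injectivity and the identities pass to any subset; surjectivity and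
    nondegeneracy do not, and come from the hypotheses on \<open>S\<close>.\<close>
  have "bij_betw (twist g) S S"
    using twist twist_inj S(1) by (auto simp: bij_betw_def inj_on_def subset_iff)
  then show ?thesis
    unfolding RQH_Lie_algebra_def quadratic_hom_Lie_algebra_def hom_Lie_algebra_def
      multiplicative_def bilinear_map_on_def linear_map_on_def
  proof (intro conjI ballI allI impI)
    fix x y assume "x \<in> carrier (g\<lparr>carrier := S\<rparr>)" "y \<in> carrier (g\<lparr>carrier := S\<rparr>)"
    then show "bracket (g\<lparr>carrier := S\<rparr>) x y = - bracket (g\<lparr>carrier := S\<rparr>) y x"
      and "form (g\<lparr>carrier := S\<rparr>) x y = form (g\<lparr>carrier := S\<rparr>) y x"
      using bracket_skew[of x y] form_sym[of x y] by (simp_all add: mem)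
  qed (use vector_space_scale S(2) bracket twist nondeg in
      \<open>simp_all add: mem jacobi twist_bracket form_invariant twist_selfadjoint\<close>)
qed

text \<open>Since B(e, e) is nonzero, g is the direct sum of the line of e and its orthogonal
  complement. Centrality kills the mixed brackets and puts all brackets into the complement; the
  eigenvector equation makes both summands stable under the twist.\<close>

lemma orthogonal_split:
  fixes g :: "('k::field, 'v::ab_group_add) hom_lie"
  assumes g: "RQH_Lie_algebra g"
    and e: "e \<in> center g" "twist g e = scale g c e" "form g e e \<noteq> 0"
  defines "V \<equiv> g\<lparr>carrier := {x \<in> carrier g. form g x e = 0}\<rparr>"
    and "W \<equiv> g\<lparr>carrier := range (\<lambda>t. scale g t e)\<rparr>"
  shows "RQH_Lie_algebra V" "RQH_Lie_algebra W" "one_dimensional W"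
    "isometric (orthogonal_sum V W) g"
proof -
  interpret RQH g by (rule RQH.intro[OF g])
  have e_mem [simp]: "e \<in> carrier g"
    using e(1) by (simp add: center_def)
  have bracket_e [simp]: "bracket g e x = 0" "bracket g x e = 0" if "x \<in> carrier g" for x
    using e(1) that bracket_skew[of x e] by (auto simp: center_def)
  have form_e_left: "form g e x = 0" if "x \<in> carrier g" "form g x e = 0" for x
    using that form_sym[of x e] by simp
  have "e \<noteq> 0"
    using e(3) by auto
  have "c \<noteq> 0"
    using twist_inj[of e 0] e(2) \<open>e \<noteq> 0\<close> by auto
  have line [simp]: "t \<cdot> e \<in> range (\<lambda>t. t \<cdot> e)" for t
    by (rule rangeI)
  have line_0 [simp]: "0 \<in> range (\<lambda>t. t \<cdot> e)" and line_e [simp]: "e \<in> range (\<lambda>t. t \<cdot> e)"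
    using line[of 0] line[of 1] by (simp_all del: line)
  show "RQH_Lie_algebra V"
    unfolding V_def
  proof (rule RQH_restrict[OF g])
    show "subspace {x \<in> carrier g. form g x e = 0}"
      by (rule subspaceI) auto
    show "{x \<in> carrier g. form g x e = 0} \<subseteq> twist g ` {x \<in> carrier g. form g x e = 0}"
    proof
      fix y assume y: "y \<in> {x \<in> carrier g. form g x e = 0}"
      then obtain x where x: "x \<in> carrier g" "y = twist g x"
        using twist_surj by blast
      \<comment> \<open>Self-adjointness gives B(twist x, e) = c B(x, e), and c is nonzero.\<close>
      moreover have "form g x e = 0"
        using y x \<open>c \<noteq> 0\<close> by (simp add: twist_selfadjoint e(2))
      ultimately show "y \<in> twist g ` {x \<in> carrier g. form g x e = 0}"
        by blast
    qed
  next
    fix x assume x: "x \<in> {x \<in> carrier g. form g x e = 0}"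
      and orth: "\<And>y. y \<in> {x \<in> carrier g. form g x e = 0} \<Longrightarrow> form g x y = 0"
    show "x = 0"
    proof (rule nondegenerate)
      fix y assume y: "y \<in> carrier g"
      \<comment> \<open>The vector paired with x is the orthogonal projection of y to the complement
        of e; as x is orthogonal to e, the correction does not change B(x, y).\<close>
      have "form g x (y - (form g y e / form g e e) \<cdot> e) = 0"
        using y e(3) by (intro orth) simp
      then show "form g x y = 0"
        using x y by simp
    qed (use x in simp)
  qed (auto simp: form_invariant twist_selfadjoint e(2))
  show "RQH_Lie_algebra W"
    unfolding W_def
  proof (rule RQH_restrict[OF g])
    show "subspace (range (\<lambda>t. t \<cdot> e))"
      by (rule subspaceI)
        (auto simp flip: scale_left_distrib)
    show "range (\<lambda>t. t \<cdot> e) \<subseteq> twist g ` range (\<lambda>t. t \<cdot> e)"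
    proof
      fix x assume "x \<in> range (\<lambda>t. t \<cdot> e)"
      then obtain t where "x = t \<cdot> e" by auto
      then have "x = twist g ((t / c) \<cdot> e)"
        using \<open>c \<noteq> 0\<close> by (simp add: e(2))
      then show "x \<in> twist g ` range (\<lambda>t. t \<cdot> e)" by blast
    qed
    show "x = 0" if "x \<in> range (\<lambda>t. t \<cdot> e)"
      and "\<And>y. y \<in> range (\<lambda>t. t \<cdot> e) \<Longrightarrow> form g x y = 0" for x
      using that(1) that(2)[OF rangeI[of _ 1]] e(3) by auto
  qed (auto simp: e(2))
  have "dim (range (\<lambda>t. t \<cdot> e)) = 1"
    using \<open>e \<noteq> 0\<close>
    by (intro dim_unique[of "{e}"]) (simp_all add: span_singleton)
  then show "one_dimensional W"
    by (simp add: W_def one_dimensional_def)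
  show "isometric (orthogonal_sum V W) g"
    unfolding isometric_def
  proof (intro exI conjI)
    let ?f = "\<lambda>(x, y). x + y :: 'v"
    have "inj_on ?f (carrier V \<times> carrier W)"
    proof (rule inj_onI)
      fix p q assume p: "p \<in> carrier V \<times> carrier W" and q: "q \<in> carrier V \<times> carrier W"
        and eq: "?f p = ?f q"
      obtain x t where x: "p = (x, t \<cdot> e)" "x \<in> carrier g" "form g x e = 0"
        using p by (auto simp: V_def W_def)
      obtain y u where y: "q = (y, u \<cdot> e)" "y \<in> carrier g" "form g y e = 0"
        using q by (auto simp: V_def W_def)
      \<comment> \<open>Pairing with e isolates the component along e.\<close>
      have "form g (x + t \<cdot> e) e = form g (y + u \<cdot> e) e"
        using eq x y by simp
      then have "t = u"
        using x y e(3) by simp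
      then show "p = q"
        using eq x y by simp
    qed
    moreover have "?f ` (carrier V \<times> carrier W) = carrier g"
    proof (intro subset_antisym subsetI)
      fix x assume x: "x \<in> carrier g"
      let ?t = "form g x e / form g e e"
      have "x = ?f (x - ?t \<cdot> e, ?t \<cdot> e)" by simp
      moreover have "(x - ?t \<cdot> e, ?t \<cdot> e) \<in> carrier V \<times> carrier W"
        using x e(3) by (simp add: V_def W_def)
      ultimately show "x \<in> ?f ` (carrier V \<times> carrier W)" by (rule image_eqI)
    qed (auto simp: V_def W_def)
    moreover have "carrier (orthogonal_sum V W) = carrier V \<times> carrier W"
      by (simp add: orthogonal_sum_def)
    ultimately show "bij_betw ?f (carrier (orthogonal_sum V W)) (carrier g)"
      by (simp only: bij_betw_def)
    have W: "\<exists>t. y = t \<cdot> e" if "y \<in> carrier W" for y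
      using that by (auto simp: W_def)
    show "linear_map_on (carrier (orthogonal_sum V W)) (scale (orthogonal_sum V W)) smul ?f"
      by (simp add: orthogonal_sum_def linear_map_on_def V_def W_def split_def
          add.assoc add.left_commute scale_right_distrib)
    show "\<forall>p\<in>carrier (orthogonal_sum V W). \<forall>q\<in>carrier (orthogonal_sum V W).
        ?f (bracket (orthogonal_sum V W) p q) = bracket g (?f p) (?f q)"
      by (auto simp: orthogonal_sum_def V_def dest!: W) (simp add: W_def)
    show "\<forall>p\<in>carrier (orthogonal_sum V W).
        ?f (twist (orthogonal_sum V W) p) = twist g (?f p)"
      by (auto simp: orthogonal_sum_def V_def dest!: W) (simp add: W_def)
    show "\<forall>p\<in>carrier (orthogonal_sum V W). \<forall>q\<in>carrier (orthogonal_sum V W).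
        form g (?f p) (?f q) = form (orthogonal_sum V W) p q"
      by (auto simp: orthogonal_sum_def V_def dest!: W) (simp add: W_def form_e_left)
  qed
qed

section \<open>Double extensions from an isotropic central eigenvector\<close>

text \<open>The reduction \<open>e\<^sup>\<bottom> / \<langle>e\<rangle>\<close>, realised inside \<open>g\<close> as the orthogonal
  complement of \<open>b\<close> in \<open>e\<^sup>\<bottom>\<close>.\<close>
definition reduction :: "('k::field, 'v::ab_group_add) hom_lie \<Rightarrow> 'v \<Rightarrow> 'v \<Rightarrow> ('k, 'v) hom_lie" where
  "reduction g e b =
     \<lparr> carrier = {x \<in> carrier g. form g x e = 0 \<and> form g x b = 0},
       scale = scale g,
       bracket = (\<lambda>x y. bracket g x y - scale g (form g (bracket g x y) b) e),
       twist = (\<lambda>x. twist g x - scale g (form g (twist g x) b) e),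
       form = form g \<rparr>"

locale RQH_isotropic = RQH g for g :: "('k::field_char_0, 'v::ab_group_add) hom_lie" +
  fixes e b :: 'v and c :: 'k
  assumes e_center: "e \<in> center g"
    and twist_e [simp]: "twist g e = scale g c e"
    and b_mem [simp]: "b \<in> carrier g"
    and form_e_e [simp]: "form g e e = 0"
    and form_e_b [simp]: "form g e b = 1"
    and form_b_b [simp]: "form g b b = 0"
begin

lemma e_mem [simp]: "e \<in> carrier g"
  using e_center by (simp add: center_def)

lemma bracket_e [simp]:
  "x \<in> carrier g \<Longrightarrow> bracket g e x = 0" "x \<in> carrier g \<Longrightarrow> bracket g x e = 0"
  using e_center bracket_skew[of x e] by (auto simp: center_def)

lemma form_b_e [simp]: "form g b e = 1"
  by (simp add: form_sym[of b e])

lemma e_nonzero: "e \<noteq> 0"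
  using form_e_b by (auto simp del: form_e_b)

lemma c_nonzero: "c \<noteq> 0"
  using twist_inj[of e 0] e_nonzero by auto

text \<open>On the orthogonal complement of e this is the quotient map modulo e, with each class
  represented by its unique member orthogonal to b.\<close>

definition proj :: "'v \<Rightarrow> 'v" where
  "proj x = x - form g x b \<cdot> e"

lemma proj_mem [simp]: "x \<in> carrier g \<Longrightarrow> proj x \<in> carrier g"
  by (simp add: proj_def)

lemma proj_linear [simp]:
  assumes "x \<in> carrier g"
  shows "y \<in> carrier g \<Longrightarrow> proj (x + y) = proj x + proj y"
    and "y \<in> carrier g \<Longrightarrow> proj (x - y) = proj x - proj y"
    and "proj (t \<cdot> x) = t \<cdot> proj x"
    and "proj (- x) = - proj x"
  using assms by (simp_all add: proj_def algebra_simps)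

lemma proj_e [simp]: "proj e = 0"
  by (simp add: proj_def)

lemma proj_0 [simp]: "proj 0 = 0"
  by (simp add: proj_def)

text \<open>Changing an argument by a multiple of the central vector e leaves brackets alone, so the
  bracket descends to the quotient. The twist descends too, since it sends e to a multiple of
  e.\<close>

lemma bracket_proj [simp]:
  assumes "x \<in> carrier g" "y \<in> carrier g"
  shows "bracket g (proj x) y = bracket g x y" "bracket g x (proj y) = bracket g x y"
  using assms by (simp_all add: proj_def)

lemma proj_twist_proj [simp]: "x \<in> carrier g \<Longrightarrow> proj (twist g (proj x)) = proj (twist g x)"
  by (simp add: proj_def algebra_simps)

lemma form_proj_e [simp]: "x \<in> carrier g \<Longrightarrow> form g (proj x) e = form g x e"
  by (simp add: proj_def)

lemma form_proj_b [simp]: "x \<in> carrier g \<Longrightarrow> form g (proj x) b = 0"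
  by (simp add: proj_def)

lemma form_proj [simp]:
  assumes "x \<in> carrier g" "y \<in> carrier g" "form g y e = 0"
  shows "form g (proj x) y = form g x y" "form g y (proj x) = form g y x"
  using assms by (simp_all add: proj_def form_sym[of e])

lemma form_twist_e [simp]: "x \<in> carrier g \<Longrightarrow> form g (twist g x) e = c * form g x e"
  by (simp add: twist_selfadjoint)

lemma form_bracket_e [simp]:
  "x \<in> carrier g \<Longrightarrow> y \<in> carrier g \<Longrightarrow> form g (bracket g x y) e = 0"
  by (simp add: form_invariant)

abbreviation V where "V \<equiv> reduction g e b"

lemma carrier_V: "x \<in> carrier V \<longleftrightarrow> x \<in> carrier g \<and> form g x e = 0 \<and> form g x b = 0"
  by (simp add: reduction_def)

lemma proj_id: "x \<in> carrier V \<Longrightarrow> proj x = x"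
  by (simp add: carrier_V proj_def)

lemma V_simps [simp]:
  shows "scale V = smul" "form V = form g"
    and "bracket V x y = proj (bracket g x y)" "twist V x = proj (twist g x)"
  by (simp_all add: reduction_def proj_def)

lemma decompose:
  assumes "x \<in> carrier g"
  obtains s v t where "x = s \<cdot> b + v + t \<cdot> e" "v \<in> carrier V"
proof
  \<comment> \<open>As e and b are isotropic with B(e, b) = 1, pairing with e reads off the
    coefficient of b, and pairing with b that of e.\<close>
  let ?s = "form g x e" and ?t = "form g x b"
  show "x = ?s \<cdot> b + (x - ?s \<cdot> b - ?t \<cdot> e) + ?t \<cdot> e" by simp
  show "x - ?s \<cdot> b - ?t \<cdot> e \<in> carrier V"
    using assms by (simp add: carrier_V)
qed

lemma subspace_V: "subspace (carrier V)"
  by (rule subspaceI) (auto simp: carrier_V)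

text \<open>The identities of g survive \<open>proj\<close>, because bracket, twist and form descend
  to the quotient. Nondegeneracy holds because the plane of b and e is orthogonal to
  \<open>carrier V\<close>.\<close>

lemma RQH_V: "RQH_Lie_algebra V"
proof -
  have mem: "x \<in> carrier g" "form g x e = 0" "form g e x = 0" "form g x b = 0" 
    if "x \<in> carrier V" for x
    using that by (auto simp: carrier_V form_sym[of e])
  have nondeg: "x = 0" if x: "x \<in> carrier V" and "\<And>y. y \<in> carrier V \<Longrightarrow> form g x y = 0" for x
  proof (rule nondegenerate)
    fix y assume "y \<in> carrier g"
    then obtain s v t where "y = s \<cdot> b + v + t \<cdot> e" "v \<in> carrier V"
      by (rule decompose)
    then show "form g x y = 0"
      using mem[OF x] that(2)[of v] by (simp add: mem)
  qed (use mem[OF x] in simp)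
  have jac: "proj (bracket g (proj (twist g x)) (proj (bracket g y z)))
      + proj (bracket g (proj (twist g y)) (proj (bracket g z x)))
      + proj (bracket g (proj (twist g z)) (proj (bracket g x y))) = 0"
    if "x \<in> carrier V" "y \<in> carrier V" "z \<in> carrier V" for x y z
    using arg_cong[OF jacobi[of x y z], of proj] that by (simp add: mem)
  \<comment> \<open>If the twist of x is a multiple of e, injectivity in g puts x on the line of e;
    orthogonality to b then forces x = 0.\<close>
  have inj: "x = 0" if x: "x \<in> carrier V" and 0: "proj (twist g x) = 0" for x
  proof -
    define t where "t = form g (twist g x) b"
    have "twist g x - t \<cdot> e = 0"
      using 0 by (simp only: proj_def t_def)
    then have "twist g x = twist g ((t / c) \<cdot> e)"
      using c_nonzero by simp
    then have x_eq: "x = (t / c) \<cdot> e"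
      using mem[OF x] by - (rule twist_inj, simp_all)
    then have "form g x b = t / c"
      by simp
    then show ?thesis
      using mem[OF x] x_eq by simp
  qed
  have "inj_on (twist V) (carrier V)"
  proof (rule inj_onI)
    fix x y assume "x \<in> carrier V" "y \<in> carrier V" "twist V x = twist V y"
    then show "x = y"
      using inj[of "x - y"] subspace_diff[OF subspace_V, of x y] by (simp add: mem)
  qed
  moreover have "twist V ` carrier V = carrier V"
  proof (intro subset_antisym subsetI)
    fix y assume y: "y \<in> carrier V"
    then obtain x where x: "x \<in> carrier g" "y = twist g x"
      using twist_surj mem by blast
    \<comment> \<open>B(y, e) = c B(x, e) places the preimage in the complement of e; projecting
      along e then moves it into \<open>carrier V\<close>.\<close>
    have "form g x e = 0"
      using mem(2)[OF y] x c_nonzero by simp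
    then have "proj x \<in> carrier V"
      using x by (simp add: carrier_V)
    moreover have "y = twist V (proj x)"
      using x proj_id[OF y] by simp
    ultimately show "y \<in> twist V ` carrier V" by blast
  qed (auto simp: carrier_V)
  ultimately have bij: "bij_betw (twist V) (carrier V) (carrier V)"
    by (simp add: bij_betw_def)
  show ?thesis
    unfolding RQH_Lie_algebra_def quadratic_hom_Lie_algebra_def hom_Lie_algebra_def
      multiplicative_def bilinear_map_on_def linear_map_on_def
  proof (intro conjI ballI allI impI)
    fix x y assume "x \<in> carrier V" "y \<in> carrier V"
    then show "bracket V x y = - bracket V y x" and "form V x y = form V y x"
      using bracket_skew[of x y] form_sym[of x y] by (simp_all add: mem)
  next
    fix x y z assume "x \<in> carrier V" "y \<in> carrier V" "z \<in> carrier V"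
    then show "bracket V (twist V x) (bracket V y z) + bracket V (twist V y) (bracket V z x)
        + bracket V (twist V z) (bracket V x y) = 0"
      by (simp only: V_simps jac)
  next
    fix x assume "x \<in> carrier V" "\<forall>y\<in>carrier V. form V x y = 0"
    then show "x = 0"
      by (intro nondeg) simp_all
  qed (use vector_space_scale subspace_V bij in
      \<open>simp_all add: carrier_V twist_bracket form_invariant twist_selfadjoint\<close>)
qed

text \<open>This is the V-component of the twist of b. The coefficient of b subtracted here is
  B(twist b, e) = B(b, c e) = c, and the coefficient of e is B(twist b, b).\<close>

abbreviation x0 where "x0 \<equiv> twist g b - c \<cdot> b - form g (twist g b) b \<cdot> e"

lemma x0_mem: "x0 \<in> carrier V"
  by (simp add: carrier_V)

text \<open>Skew-symmetry yields 2 [b, b] = 0, and 2 is invertible in characteristic 0.\<close>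

lemma bracket_b_b [simp]: "bracket g b b = 0"
proof -
  have "bracket g b b + bracket g b b = 0"
    using bracket_skew[OF b_mem b_mem] by (rule eq_neg_iff_add_eq_0[THEN iffD1])
  then have "(1 + 1) \<cdot> bracket g b b = 0"
    by (simp only: scale_left_distrib scale_one)
  then show ?thesis by simp
qed

text \<open>Orthogonality to b comes from B([x, b], b) = B(x, [b, b]) = 0, so [b, x] needs no
  projection.\<close>

lemma bracket_b_mem: "x \<in> carrier V \<Longrightarrow> bracket g b x \<in> carrier V"
  using form_invariant[of x b b] bracket_skew[of b x] by (simp add: carrier_V)

text \<open>This identifies the e-component of [x, y] with the term B(\<delta> x, y) of a double
  extension, where \<delta> = [b, -].\<close>

lemma form_bracket_b:
  "x \<in> carrier g \<Longrightarrow> y \<in> carrier g \<Longrightarrow> form g (bracket g x y) b = form g (bracket g b x) y"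
  using form_sym[of "bracket g x y" b] form_invariant[of b x y] by simp

text \<open>Modulo e the twist of b is c b + \<open>x0\<close>, and e is central, so each
  compatibility equation is a statement about brackets with the twist of b. The first comes from
  multiplicativity, the other two from the Hom-Jacobi identity.\<close>

lemma double_extension_data_reduction: "double_extension_data V (bracket g b) x0 c"
proof -
  have mem: "x \<in> carrier g" "form g x e = 0" "form g x b = 0" if "x \<in> carrier V" for x
    using that by (auto simp: carrier_V)
  have proj_b: "proj (bracket g b x) = bracket g b x" if "x \<in> carrier g" for x
    using that form_invariant[of x b b] bracket_skew[of b x] by (simp add: proj_def)
  have "twist V (bracket g b (twist V x)) - c \<cdot> bracket g b x = bracket V x0 x"
    if "x \<in> carrier V" for x
  proof -
    have x: "x \<in> carrier g" using mem[OF that] by simp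
    \<comment> \<open>Multiplicativity produces the squared twist of x, which acts in brackets like
      x itself.\<close>
    have "twist g (bracket g b (twist g x)) = bracket g (twist g b) (twist g (twist g x))"
      using x by (simp add: twist_bracket)
    also have "\<dots> = bracket g (twist g b) x"
      using x bracket_twist_twist[of x "twist g b"] bracket_skew[of "twist g b"] by simp
    finally show ?thesis
      using x by (simp add: proj_b)
  qed
  moreover have "twist V (bracket g b (bracket g b x)) - bracket g b (bracket g b (twist V x))
      = bracket V (bracket g b x0) x" if "x \<in> carrier V" for x
  proof -
    have x: "x \<in> carrier g" using mem[OF that] by simp
    \<comment> \<open>This is Hom-Jacobi for b, \<open>twist g b\<close> and
      \<open>twist g x\<close>, with squared twists removed from brackets. It suffices because
      [b, \<open>x0\<close>] = [b, \<open>twist g b\<close>].\<close>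
    have "bracket g (twist g b) (bracket g (twist g b) (twist g x))
        - bracket g b (bracket g b (twist g x)) = bracket g (bracket g b (twist g b)) x"
    proof -
      have "bracket g (twist g (twist g b)) (bracket g (twist g x) b)
          = - bracket g b (bracket g b (twist g x))"
        using x bracket_skew[of "twist g x" b] by (simp add: bracket_twist_twist)
      moreover have "bracket g (twist g (twist g x)) (bracket g b (twist g b))
          = - bracket g (bracket g b (twist g b)) x"
        using x bracket_skew[of x "bracket g b (twist g b)"] by (simp add: bracket_twist_twist)
      ultimately show ?thesis
        using jacobi[of b "twist g b" "twist g x"] x by (simp add: algebra_simps)
    qed
    then have "proj (bracket g (twist g b) (bracket g (twist g b) (twist g x)))
        - proj (bracket g b (bracket g b (twist g x))) = proj (bracket g (bracket g b (twist g b)) x)"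
      using x by (simp flip: proj_linear(2))
    then show ?thesis
      using x by (simp add: twist_bracket proj_b)
  qed
  moreover have "c \<cdot> bracket g b (bracket V x y) + bracket V x0 (bracket V x y)
      = bracket V (bracket g b x) (twist V y) + bracket V (twist V x) (bracket g b y)"
    if "x \<in> carrier V" "y \<in> carrier V" for x y
  proof -
    have xy: "x \<in> carrier g" "y \<in> carrier g" using mem that by simp_all
    \<comment> \<open>This is Hom-Jacobi for b, x and y; splitting the twist of b on the left gives
      the third equation.\<close>
    have "bracket g (twist g b) (bracket g x y)
        = bracket g (bracket g b x) (twist g y) + bracket g (twist g x) (bracket g b y)"
    proof -
      have "bracket g (twist g x) (bracket g y b) = - bracket g (twist g x) (bracket g b y)"
        using xy bracket_skew[of y b] by simp
      moreover have "bracket g (twist g y) (bracket g b x)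
          = - bracket g (bracket g b x) (twist g y)"
        using xy by (intro bracket_skew) simp_all
      ultimately show ?thesis
        using jacobi[of b x y] xy by (simp add: algebra_simps)
    qed
    then have "proj (bracket g (twist g b) (bracket g x y))
        = proj (bracket g (bracket g b x) (twist g y)) + proj (bracket g (twist g x) (bracket g b y))"
      using xy by (simp flip: proj_linear(1))
    then show ?thesis
      using xy by (simp add: proj_b)
  qed
  moreover have "form g (bracket g b x) y = - form g x (bracket g b y)"
    if "x \<in> carrier V" "y \<in> carrier V" for x y
    using mem[OF that(1)] mem[OF that(2)] bracket_skew[of b x] by (simp add: form_invariant)
  moreover have "linear_map_on (carrier V) smul smul (bracket g b)"
    by (simp add: linear_map_on_def mem)
  ultimately show ?thesis
    unfolding double_extension_data_def V_simps(1,2)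
    by (intro conjI ballI RQH_V bracket_b_mem x0_mem c_nonzero; blast)
qed

lemma isometric_reduction:
  "isometric (double_extension V (bracket g b) x0 c (form g (twist g b) b)) g"
    (is "isometric ?D g")
proof -
  have mem: "x \<in> carrier g" "form g x e = 0" "form g e x = 0" "form g x b = 0" "form g b x = 0"
    if "x \<in> carrier V" for x
    using that form_sym[of e x] form_sym[of b x] by (simp_all add: carrier_V)
  let ?f = "\<lambda>(s, x, t). s \<cdot> b + x + t \<cdot> e"
  have D: "carrier ?D = UNIV \<times> carrier V \<times> UNIV"
    by (simp add: double_extension_def)
  have "inj_on ?f (UNIV \<times> carrier V \<times> UNIV)"
  proof (rule inj_onI)
    fix p q assume "p \<in> UNIV \<times> carrier V \<times> UNIV" "q \<in> UNIV \<times> carrier V \<times> UNIV"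
      and eq: "?f p = ?f q"
    then obtain s x t s' x' t' where p: "p = (s, x, t)" "x \<in> carrier V"
      and q: "q = (s', x', t')" "x' \<in> carrier V"
      by blast
    have "form g (?f p) e = s" "form g (?f q) e = s'" "form g (?f p) b = t" "form g (?f q) b = t'"
      using mem[OF p(2)] mem[OF q(2)] by (simp_all add: p(1) q(1))
    then show "p = q"
      using eq by (simp add: p(1) q(1))
  qed
  moreover have "?f ` (UNIV \<times> carrier V \<times> UNIV) = carrier g"
  proof (intro subset_antisym subsetI)
    fix x assume "x \<in> carrier g"
    then obtain s v t where "x = s \<cdot> b + v + t \<cdot> e" "v \<in> carrier V"
      by (rule decompose)
    then show "x \<in> ?f ` (UNIV \<times> carrier V \<times> UNIV)"
      by (intro image_eqI[of _ _ "(s, v, t)"]) simp_all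
  next
    fix y assume "y \<in> ?f ` (UNIV \<times> carrier V \<times> UNIV)"
    then obtain s v t where "y = s \<cdot> b + v + t \<cdot> e" "v \<in> carrier V"
      by auto
    then show "y \<in> carrier g"
      by (simp add: mem)
  qed
  ultimately have "bij_betw ?f (carrier ?D) (carrier g)"
    by (simp only: D bij_betw_def)
  moreover have "linear_map_on (carrier ?D) (scale ?D) smul ?f"
    by (simp add: linear_map_on_def double_extension_def scale_left_distrib scale_right_distrib
        split_def add.assoc add.left_commute)
  moreover have "?f (bracket ?D p q) = bracket g (?f p) (?f q)"
    if pq: "p \<in> carrier ?D" "q \<in> carrier ?D" for p q
  proof -
    obtain s x t s' x' t' where p: "p = (s, x, t)" "x \<in> carrier V"
      and q: "q = (s', x', t')" "x' \<in> carrier V"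
      using pq unfolding D by blast
    \<comment> \<open>The multiple of e removed by \<open>proj\<close> is exactly what the double
      extension stores in its last coordinate.\<close>
    have "proj (bracket g x x') + form g (bracket g b x) x' \<cdot> e = bracket g x x'"
      using mem[OF p(2)] mem[OF q(2)] by (simp add: proj_def form_bracket_b)
    then have "bracket g x x' = proj (bracket g x x') + form g (bracket g b x) x' \<cdot> e"
      by (rule sym)
    moreover have "bracket g x b = - bracket g b x"
      using mem[OF p(2)] by (intro bracket_skew) simp_all
    moreover have "?f (bracket ?D p q)
        = s \<cdot> bracket g b x' - s' \<cdot> bracket g b x
          + (proj (bracket g x x') + form g (bracket g b x) x' \<cdot> e)"
      by (simp add: p(1) q(1) double_extension_def algebra_simps)
    moreover have "bracket g (?f p) (?f q)
        = s \<cdot> bracket g b x' + s' \<cdot> bracket g x b + bracket g x x'"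
      using mem[OF p(2)] mem[OF q(2)] by (simp add: p(1) q(1) algebra_simps)
    ultimately show ?thesis by simp
  qed
  moreover have "?f (twist ?D p) = twist g (?f p)" if pD: "p \<in> carrier ?D" for p
  proof -
    obtain s x t where p: "p = (s, x, t)" "x \<in> carrier V"
      using pD unfolding D by blast
    \<comment> \<open>Both b and e are orthogonal to x, so B(\<open>x0\<close>, x) = B(twist b, x) =
      B(b, twist x): the e-component that \<open>proj\<close> removes from the twist.\<close>
    have "form g x0 x = form g (twist g x) b"
      using mem[OF p(2)] by (simp add: twist_selfadjoint form_sym[of x])
    then have "proj (twist g x) + form g x0 x \<cdot> e = twist g x"
      by (simp add: proj_def)
    moreover have "?f (twist ?D p)
        = s \<cdot> twist g b + (proj (twist g x) + form g x0 x \<cdot> e) + (c * t) \<cdot> e"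
      by (simp add: p(1) double_extension_def algebra_simps)
    moreover have "twist g (?f p) = s \<cdot> twist g b + twist g x + (c * t) \<cdot> e"
      using mem[OF p(2)] by (simp add: p(1) mult.commute)
    ultimately show ?thesis by simp
  qed
  moreover have "form g (?f p) (?f q) = form ?D p q"
    if pq: "p \<in> carrier ?D" "q \<in> carrier ?D" for p q
  proof -
    obtain s x t s' x' t' where p: "p = (s, x, t)" "x \<in> carrier V"
      and q: "q = (s', x', t')" "x' \<in> carrier V"
      using pq unfolding D by blast
    show ?thesis
      using mem[OF p(2)] mem[OF q(2)] by (simp add: p(1) q(1) double_extension_def)
  qed
  ultimately show ?thesis
    unfolding isometric_def by (intro exI[of _ ?f] conjI ballI; blast)
qed

end

text \<open>Normalise z so that B(e, z) = 1. Then B(z - t e, z - t e) = B(z, z) - 2 t, so t = B(z,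
  z) / 2 makes the vector isotropic without changing its pairing with e.\<close>

lemma (in RQH) hyperbolic_partner:
  assumes e: "e \<in> carrier g" "e \<noteq> 0" "form g e e = 0" and two: "(2 :: 'k) \<noteq> 0"
  obtains b where "b \<in> carrier g" "form g e b = 1" "form g b b = 0"
proof -
  obtain y where y: "y \<in> carrier g" "form g e y \<noteq> 0"
    using nondegenerate[OF e(1)] e(2) by blast
  define z where "z = inverse (form g e y) \<cdot> y"
  have z: "z \<in> carrier g" "form g e z = 1"
    using y e(1) by (simp_all add: z_def)
  have ze: "form g z e = 1"
    using z e(1) form_sym[of z e] by simp
  define b where "b = z - (form g z z / 2) \<cdot> e"
  show thesis
  proof
    show "b \<in> carrier g" "form g e b = 1"
      using z e by (simp_all add: b_def)
    have "form g b b = form g z z - 2 * (form g z z / 2)"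
      using z ze e by (simp add: b_def algebra_simps)
    then show "form g b b = 0"
      using two by simp
  qed
qed

section \<open>Induction on the size of a finite spanning set\<close>

theorem proposition7p4:
  fixes g :: "('k::{alg_closed_field, field_char_0}, 'v::ab_group_add) hom_lie"
  assumes "RQH_Lie_algebra g" and "finite_dimensional g"
  shows "\<exists>g0. IQH_Lie_algebra g0 \<and> centerless g0 \<and> obtained_from g0 g"
proof -
  obtain S where "finite S" "module.span (scale g) S = carrier g"
    using assms(2) by (auto simp: finite_dimensional_def)
  with assms(1) show ?thesis
  proof (induction "card S" arbitrary: S g rule: less_induct)
    case less
    interpret RQH g by (rule RQH.intro[OF less.prems(1)])
    \<comment> \<open>The induction hypothesis is packaged for an algebra on a proper subspace of
      \<open>carrier g\<close>, with e witnessing properness; its bracket and twist may differ from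
      those of g, as in \<open>reduction\<close>.\<close>
    have smaller: "\<exists>g0. IQH_Lie_algebra g0 \<and> centerless g0 \<and> obtained_from g0 V"
      if V: "RQH_Lie_algebra V" "scale V = scale g" "carrier V \<subseteq> carrier g"
        and e: "e \<in> carrier g" "e \<notin> carrier V" for V e
    proof -
      have "module.subspace (scale g) (carrier V)"
        using RQH.RQH_conjuncts(2)[OF RQH.intro[OF V(1)]] V(2) by simp
      then obtain T where "finite T" "card T < card S" "span T = carrier V"
        using proper_subspace_span_card[of S "carrier V" e] less.prems V(3) e by auto
      then show ?thesis
        using less.hyps[of T V] V(1,2) by simp
    qed
    show ?case
    proof (cases "centerless g")
      case True
      then show ?thesis
        using centerless_imp_IQH obtained_from.start by blast
    next
      case False
      then obtain z where z: "z \<in> center g" "z \<noteq> 0"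
        using subspace_0[OF subspace_center] by (auto simp: centerless_def)
      have center_sub: "center g \<subseteq> carrier g"
        by (auto simp: center_def)
      \<comment> \<open>The eigenvector is sought in the center because both reductions rely on e
        being central.\<close>
      have "linear_map_on (center g) (scale g) (scale g) (twist g)"
        using center_sub by (simp add: linear_map_on_def subset_iff)
      then obtain e c where e: "e \<in> center g" "e \<noteq> 0" "twist g e = scale g c e"
        using eigenvector_exists[OF vector_space_scale less.prems(2) subspace_center, of "twist g" z]
          center_sub less.prems(3) twist_center z by auto
      have e_mem: "e \<in> carrier g"
        using e(1) center_sub by blast
      show ?thesis
      proof (cases "form g e e = 0")
        case False
        define V where "V = g\<lparr>carrier := {x \<in> carrier g. form g x e = 0}\<rparr>"
        define W where "W = g\<lparr>carrier := range (\<lambda>t. scale g t e)\<rparr>"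
        note split = orthogonal_split[OF less.prems(1) e(1,3) False, folded V_def W_def]
        obtain g0 where "IQH_Lie_algebra g0" "centerless g0" "obtained_from g0 V"
          using smaller[OF split(1), of e] e_mem False by (auto simp: V_def)
        then show ?thesis
          using orth_sum_one_dim[OF _ split] by blast
      next
        case True
        obtain b where b: "b \<in> carrier g" "form g e b = 1" "form g b b = 0"
          using hyperbolic_partner[OF e_mem e(2) True] by auto
        interpret iso: RQH_isotropic g e b c
          by unfold_locales (use e b True in auto)
        \<comment> \<open>Here e is orthogonal to itself; what keeps it out of the smaller carrier
          is B(e, b) = 1.\<close>
        obtain g0 where "IQH_Lie_algebra g0" "centerless g0" "obtained_from g0 iso.V"
          using smaller[OF iso.RQH_V, of e] e_mem b(2) by (auto simp: reduction_def)
        then show ?thesis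
          using double_ext[OF _ iso.double_extension_data_reduction iso.isometric_reduction] by blast
      qed
    qed
  qed
qed

end
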